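(* Let $t\ge 3$ and let $q_1\ge q_2\ge\cdots\ge q_t$ be the orders of finite fields. Among all intersecting families $\mathcal F$ of nonempty proper subsets of $[t]$, there is one of maximum weight $\sum_{A\in\mathcal F}f(A)$ which is shifted, i.e. $\operatorname{sh}_{ij}(\mathcal F)=\mathcal F$ for every $i<j$ with $q_i\ge q_j$.
   Context: $[t]=\{1,\dots,t\}$. A family $\mathcal F$ of subsets of $[t]$ is intersecting if $A\cap B\ne\emptyset$ for all $A,B\in\mathcal F$. The weight function is $f(A)=\prod_{\ell\in A}(q_\ell-1)$ if $|A|\le t-2$ and $f(A)=1$ if $|A|=t-1$, for nonempty proper $A\subsetneq[t]$. For $i\ne j$ in $[t]$, the $(i,j)$-shift of a family $\mathcal F$ of nonempty proper subsets of $[t]$ is $\operatorname{sh}_{ij}(\mathcal F)=\{S_{ij}(A):A\in\mathcal F\}$, where $S_{ij}(A)=(A\setminus\{j\})\cup\{i\}$ if $j\in A$, $i\notin A$ and $(A\setminus\{j\})\cup\{i\}\notin\mathcal F$, and $S_{ij}(A)=A$ otherwise. *)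

theory Defs
  imports "HOL-Algebra.Ring" "HOL-Algebra.Coset"
begin

definition nonempty_proper_subsets :: "nat \<Rightarrow> nat set set" where
  "nonempty_proper_subsets t = {A. A \<noteq> {} \<and> A \<subset> {1..t}}"

text \<open>The case \<open>A = B\<close> is included.\<close>

definition intersecting :: "nat set set \<Rightarrow> bool" where
  "intersecting F \<longleftrightarrow> (\<forall>A\<in>F. \<forall>B\<in>F. A \<inter> B \<noteq> {})"

text \<open>Only meaningful for nonempty proper subsets of \<open>{1..t}\<close>, where the
  \<open>else\<close> branch is exactly the case \<open>card A = t - 1\<close>. Integer-valued, so that
  \<open>q l - 1\<close> is not truncated.\<close>

definition set_weight :: "nat \<Rightarrow> (nat \<Rightarrow> nat) \<Rightarrow> nat set \<Rightarrow> int" where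
  "set_weight t q A = (if card A \<le> t - 2 then (\<Prod>l\<in>A. int (q l) - 1) else 1)"

definition family_weight :: "nat \<Rightarrow> (nat \<Rightarrow> nat) \<Rightarrow> nat set set \<Rightarrow> int" where
  "family_weight t q F = (\<Sum>A\<in>F. set_weight t q A)"

definition shift_set :: "nat \<Rightarrow> nat \<Rightarrow> nat set set \<Rightarrow> nat set \<Rightarrow> nat set" where
  "shift_set i j F A =
    (if j \<in> A \<and> i \<notin> A \<and> (A - {j}) \<union> {i} \<notin> F then (A - {j}) \<union> {i} else A)"

definition shift_family :: "nat \<Rightarrow> nat \<Rightarrow> nat set set \<Rightarrow> nat set set" where
  "shift_family i j F = shift_set i j F ` F"

definition shifted_family :: "nat \<Rightarrow> (nat \<Rightarrow> nat) \<Rightarrow> nat set set \<Rightarrow> bool" where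
  "shifted_family t q F \<longleftrightarrow>
    (\<forall>i\<in>{1..t}. \<forall>j\<in>{1..t}. i < j \<and> q i \<ge> q j \<longrightarrow> shift_family i j F = F)"

end

(* Shifts preserve cardinality and the intersecting property, and replacing j by i with
   q i >= q j does not decrease the weight of a set. Hence shifting keeps a family of maximum
   weight maximal, while for i < j a nontrivial shift strictly decreases the sum of all elements
   of all members. A maximum weight family minimising that sum is therefore shifted. *)

theory Submission
  imports Defs
begin

lemma shift_set_cases:
  obtains "shift_set i j F A = A"
  | "j \<in> A" "i \<notin> A" "insert i (A - {j}) \<notin> F" "shift_set i j F A = insert i (A - {j})"
  by (cases "j \<in> A \<and> i \<notin> A \<and> insert i (A - {j}) \<notin> F") (auto simp: shift_set_def)

text \<open>A moved set lies outside \<open>F\<close>, so it cannot equal a fixed member. Two moved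
  sets with the same image coincide, since putting \<open>j\<close> back in place of
  \<open>i\<close> recovers each of them.\<close>

lemma inj_on_shift_set: "inj_on (shift_set i j F) F"
proof (rule inj_onI)
  fix A B assume "A \<in> F" "B \<in> F" and eq: "shift_set i j F A = shift_set i j F B"
  have restore: "A = B" if "j \<in> A" "j \<in> B" "i \<notin> A" "i \<notin> B"
      "insert i (A - {j}) = insert i (B - {j})"
  proof -
    from that have "A - {j} = B - {j}" by (simp add: insert_ident)
    with that show "A = B" by (metis insert_Diff)
  qed
  show "A = B"
    by (cases i j F A rule: shift_set_cases; cases i j F B rule: shift_set_cases)
      (use \<open>A \<in> F\<close> \<open>B \<in> F\<close> eq restore in metis)+
qed

text \<open>Injectivity lets both the weight and the element sum of a shifted family be compared
  with those of \<open>F\<close> term by term.\<close>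

lemma sum_shift_family:
  "sum w (shift_family i j F) = (\<Sum>A\<in>F. w (shift_set i j F A))"
  unfolding shift_family_def by (simp add: sum.reindex inj_on_shift_set)

lemma card_exchange:
  assumes "finite A" "j \<in> A" "i \<notin> A"
  shows "card (insert i (A - {j})) = card A"
  using assms by (metis Diff_iff card_Suc_Diff1 card_insert_disjoint finite_Diff)

lemma shift_family_nonempty_proper:
  assumes F: "F \<subseteq> nonempty_proper_subsets t" and i: "i \<in> {1..t}"
  shows "shift_family i j F \<subseteq> nonempty_proper_subsets t"
proof -
  have "shift_set i j F A \<in> nonempty_proper_subsets t" if "A \<in> F" for A
  proof (cases i j F A rule: shift_set_cases)
    case 1
    with that F show ?thesis by auto
  next
    case 2
    from that F have A: "A \<noteq> {}" "A \<subset> {1..t}" by (auto simp: nonempty_proper_subsets_def)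
    \<comment> \<open>The removed element \<open>j\<close> witnesses that the new set is still
      proper.\<close>
    with 2 have "j \<in> {1..t} - insert i (A - {j})" by auto
    with A 2 i show ?thesis by (auto simp: nonempty_proper_subsets_def)
  qed
  then show ?thesis by (auto simp: shift_family_def)
qed

text \<open>Two fixed sets are members of \<open>F\<close> and two moved sets share
  \<open>i\<close>; only a moved set against a fixed one needs an argument, given in
  \<open>moved\<close>.\<close>

lemma intersecting_shift_family:
  assumes F: "intersecting F"
  shows "intersecting (shift_family i j F)"
proof -
  have meet: "A \<inter> B \<noteq> {}" if "A \<in> F" "B \<in> F" for A B
    using that F by (auto simp: intersecting_def)
  have moved: "insert i (A - {j}) \<inter> B \<noteq> {}"
    if A: "A \<in> F" "j \<in> A" "i \<notin> A" and B: "B \<in> F" "shift_set i j F B = B" for A B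
  proof (cases "i \<notin> B \<and> j \<in> B")
    case True
    \<comment> \<open>\<open>B\<close> is blocked by its own exchange, which is therefore available to meet \<open>A\<close>.\<close>
    with B have "insert i (B - {j}) \<in> F" by (auto simp: shift_set_def split: if_splits)
    with A meet[of A "insert i (B - {j})"] show ?thesis by auto
  next
    case False
    \<comment> \<open>Either \<open>i\<close> is a common element, or \<open>j\<close> is not in
      \<open>B\<close> and every common element of \<open>A\<close> and \<open>B\<close> survives
      the exchange.\<close>
    with A B meet[of A B] show ?thesis by auto
  qed
  have "shift_set i j F A \<inter> shift_set i j F B \<noteq> {}" if "A \<in> F" "B \<in> F" for A B
    by (cases i j F A rule: shift_set_cases; cases i j F B rule: shift_set_cases)
      (use that meet[of A B] moved[of A B] moved[of B A] in auto)
  then show ?thesis by (auto simp: intersecting_def shift_family_def)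
qed

text \<open>The exchange keeps the cardinality, so both weights fall under the same branch. In the
  product branch one factor is replaced by one at least as large, and \<open>pos\<close> makes the
  remaining factors nonnegative.\<close>

lemma set_weight_exchange:
  assumes "finite A" "j \<in> A" "i \<notin> A" and "q j \<le> q i" and pos: "\<And>l. l \<in> A \<Longrightarrow> 1 \<le> q l"
  shows "set_weight t q A \<le> set_weight t q (insert i (A - {j}))"
proof -
  have "(\<Prod>l\<in>A. int (q l) - 1) = (int (q j) - 1) * (\<Prod>l\<in>A - {j}. int (q l) - 1)"
    using assms by (simp add: prod.remove)
  also have "\<dots> \<le> (int (q i) - 1) * (\<Prod>l\<in>A - {j}. int (q l) - 1)"
    using \<open>q j \<le> q i\<close> by (intro mult_right_mono prod_nonneg) (use pos in force)+
  also have "\<dots> = (\<Prod>l\<in>insert i (A - {j}). int (q l) - 1)"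
    using assms by simp
  finally show ?thesis
    unfolding set_weight_def card_exchange[OF assms(1-3)] by simp
qed

lemma family_weight_shift_family:
  assumes F: "F \<subseteq> nonempty_proper_subsets t" and "q j \<le> q i"
    and pos: "\<And>l. l \<in> {1..t} \<Longrightarrow> 1 \<le> q l"
  shows "family_weight t q F \<le> family_weight t q (shift_family i j F)"
  unfolding family_weight_def sum_shift_family
proof (rule sum_mono)
  fix A assume "A \<in> F"
  with F have A: "A \<subseteq> {1..t}" by (auto simp: nonempty_proper_subsets_def)
  then have "finite A" by (rule finite_subset) simp
  moreover have "1 \<le> q l" if "l \<in> A" for l using that A pos by blast
  ultimately show "set_weight t q A \<le> set_weight t q (shift_set i j F A)"
    using set_weight_exchange[of A j i q t] \<open>q j \<le> q i\<close>
    by (cases i j F A rule: shift_set_cases) simp_all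
qed

lemma sum_exchange_less:
  fixes i j :: nat
  assumes "finite A" "j \<in> A" "i \<notin> A" "i < j"
  shows "\<Sum>(insert i (A - {j})) < \<Sum>A"
  using assms by (simp add: sum.remove[of A j])

text \<open>This is the descent measure: each moved set loses \<open>j - i\<close>, fixed sets lose
  nothing, and a family that changes has at least one moved member.\<close>

lemma sum_shift_family_less:
  assumes fin: "finite F" "\<And>A. A \<in> F \<Longrightarrow> finite A"
    and "i < j" and neq: "shift_family i j F \<noteq> F"
  shows "sum \<Sum> (shift_family i j F) < sum \<Sum> F"
  unfolding sum_shift_family
proof (rule sum_strict_mono_ex1)
  have less: "\<Sum>(shift_set i j F A) < \<Sum>A" if "A \<in> F" "shift_set i j F A \<noteq> A" for A
    using that sum_exchange_less[of A j i] fin(2)[OF that(1)] \<open>i < j\<close>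
    by (cases i j F A rule: shift_set_cases) auto
  show "\<forall>A\<in>F. \<Sum>(shift_set i j F A) \<le> \<Sum>A"
    using less by (metis le_less)
  from neq obtain A where "A \<in> F" "shift_set i j F A \<noteq> A"
    unfolding shift_family_def by force
  with less show "\<exists>A\<in>F. \<Sum>(shift_set i j F A) < \<Sum>A" by blast
qed (fact fin(1))

lemma finite_nonempty_proper_subsets: "finite (nonempty_proper_subsets t)"
  by (rule finite_subset[of _ "Pow {1..t}"]) (auto simp: nonempty_proper_subsets_def)

theorem corollary8p4:
  fixes t :: nat
    and K :: "nat \<Rightarrow> 'a ring"
    and q :: "nat \<Rightarrow> nat"
  assumes "t \<ge> 3"
    and "\<And>l. l \<in> {1..t} \<Longrightarrow> field (K l)"
    and "\<And>l. l \<in> {1..t} \<Longrightarrow> finite (carrier (K l))"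
    and "\<And>l. l \<in> {1..t} \<Longrightarrow> q l = order (K l)"
    and "\<And>i j. i \<in> {1..t} \<Longrightarrow> j \<in> {1..t} \<Longrightarrow> i \<le> j \<Longrightarrow> q i \<ge> q j"
  shows "\<exists>F. F \<subseteq> nonempty_proper_subsets t \<and> intersecting F
    \<and> (\<forall>G. G \<subseteq> nonempty_proper_subsets t \<and> intersecting G
          \<longrightarrow> family_weight t q G \<le> family_weight t q F)
    \<and> shifted_family t q F"
proof -
  have pos: "1 \<le> q l" if "l \<in> {1..t}" for l
  proof -
    interpret field "K l" using assms(2) that .
    \<comment> \<open>The carrier contains zero, so its finite cardinality is positive.\<close>
    have "carrier (K l) \<noteq> {}" by blast
    then show ?thesis
      using assms(3,4)[OF that] by (simp add: order_def Suc_le_eq card_gt_0_iff)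
  qed
  define X where "X = {F. F \<subseteq> nonempty_proper_subsets t \<and> intersecting F}"
  define M where "M = {F \<in> X. \<forall>G\<in>X. family_weight t q G \<le> family_weight t q F}"
  have "finite X"
    unfolding X_def using finite_nonempty_proper_subsets by simp
  \<comment> \<open>The empty family is vacuously intersecting, so the maximum is taken over a
    nonempty set.\<close>
  moreover have "{} \<in> X" by (simp add: X_def intersecting_def)
  ultimately have "Max (family_weight t q ` X) \<in> family_weight t q ` X"
    by (intro Max_in) auto
  then obtain F0 where "F0 \<in> X" "family_weight t q F0 = Max (family_weight t q ` X)"
    by auto
  with \<open>finite X\<close> have "F0 \<in> M" by (simp add: M_def)
  then obtain F where "F \<in> M" and least: "\<And>G. G \<in> M \<Longrightarrow> sum \<Sum> F \<le> sum \<Sum> G"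
    using ex_has_least_nat[of "\<lambda>F. F \<in> M" _ "sum \<Sum>"] by blast
  then have sub: "F \<subseteq> nonempty_proper_subsets t" and int: "intersecting F"
    and maximal: "\<And>G. G \<in> X \<Longrightarrow> family_weight t q G \<le> family_weight t q F"
    by (auto simp: M_def X_def)
  have "finite F" using sub finite_nonempty_proper_subsets by (rule finite_subset)
  have "finite A" if "A \<in> F" for A
  proof (rule finite_subset)
    show "A \<subseteq> {1..t}" using that sub by (auto simp: nonempty_proper_subsets_def)
  qed simp
  note less = sum_shift_family_less[OF \<open>finite F\<close> this]
  have "shift_family i j F = F" if "i \<in> {1..t}" "i < j" "q j \<le> q i" for i j
  proof (rule ccontr)
    assume neq: "shift_family i j F \<noteq> F"
    have "shift_family i j F \<in> X"
      using shift_family_nonempty_proper[OF sub that(1)] intersecting_shift_family[OF int]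
      by (simp add: X_def)
    moreover have "family_weight t q F \<le> family_weight t q (shift_family i j F)"
      using sub that(3) pos by (rule family_weight_shift_family)
    \<comment> \<open>Its weight is at least the maximum attained by \<open>F\<close>, so the
      shifted family competes in the minimisation over \<open>M\<close>, where its smaller element
      sum contradicts \<open>least\<close>.\<close>
    ultimately have "shift_family i j F \<in> M"
      using maximal by (auto simp: M_def intro: order_trans)
    then show False using least less[OF _ that(2) neq] by (simp add: leD)
  qed
  then have "shifted_family t q F" by (simp add: shifted_family_def)
  with sub int maximal show ?thesis by (auto simp: X_def)
qed

end
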